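(* Let $\{p_k\}_{k\in\mathbb{Z}}$ be a real sequence with $1<p^-\le p^+<\infty$, where $p^-:=\inf_{k}p_k$ and $p^+:=\sup_k p_k$; let $a,b:\mathbb{Z}\to(0,+\infty)$ and let $f_k:\mathbb{R}\to\mathbb{R}$, $k\in\mathbb{Z}$, be continuous, with $F_k(t):=\int_0^t f_k(s)\,ds$. Assume: (A) $b_k\to+\infty$ as $|k|\to\infty$; (F1) $f_k(0)=0$ for all $k\in\mathbb{Z}$; (F2) $\sum_{k\in\mathbb{Z}}\max_{|t|\le T}|f_k(t)|<\infty$ for every $T>0$; (F3) there exist sequences $\{c_n\}_{n\in\mathbb{N}},\{d_n\}_{n\in\mathbb{N}}$ such that $0<d_{n+1}<c_n<d_n$ for all $n$, $\lim_{n\to\infty}d_n=0$, and $f_k(t)\le 0$ for every $k\in\mathbb{Z}$, $n\in\mathbb{N}$ and $t\in[c_n,d_n]$. Assume moreover that at least one of the following two conditions holds: (F5) $\displaystyle\max\left\{\limsup_{(k,t)\to(+\infty,0^+)}\frac{F_k(t)}{(a_{k-1}+a_k+b_k)t^{p^-}},\ \limsup_{(k,t)\to(-\infty,0^+)}\frac{F_k(t)}{(a_{k-1}+a_k+b_k)t^{p^-}}\right\}>\frac1{p^-}$; (F6) $\displaystyle\sup_{k\in\mathbb{Z}}\left(\limsup_{t\to0^+}\frac{F_k(t)}{(a_{k-1}+a_k+b_k)t^{p^-}}\right)>\frac1{p^-}$. Then the problem $$-\nabla^-\left(a_k|\nabla^+u_k|^{p_k-2}\nabla^+u_k\right)+b_k|u_k|^{p_k-2}u_k=f_k(u_k)\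 \ (k\in\mathbb{Z}),\qquad u_k\to0\ \text{ as } |k|\to\infty,$$ has a sequence $\{u^n\}_{n\in\mathbb{N}}\subset E$ of positive solutions (i.e. $u^n_k>0$ for all $k\in\mathbb{Z}$) with $\|u^n\|_E\to0$ as $n\to\infty$.
   Context: Notation: for $u:\mathbb{Z}\to\mathbb{R}$, $\nabla^-u_k=u_k-u_{k-1}$ and $\nabla^+u_k=u_{k+1}-u_k$; in particular $\nabla^-$ in the equation acts on the sequence $k\mapsto a_k|\nabla^+u_k|^{p_k-2}\nabla^+u_k$. The expression $|x|^{p-2}x$ is understood as $0$ at $x=0$. $l^{p_k}(\mathbb{Z})=\{u:\mathbb{Z}\to\mathbb{R}:\sum_{k\in\mathbb{Z}}|u_k|^{p_k}<\infty\}$, and $$E=\Big\{u\in l^{p_k}(\mathbb{Z}):\ \sum_{k\in\mathbb{Z}}\big(a_k|\nabla^+u_k|^{p_k}+b_k|u_k|^{p_k}\big)<\infty\Big\},$$ with norm $\|u\|_E=\inf\{\eta>0:\sum_{k\in\mathbb{Z}}(a_k|\nabla^+u_k/\eta|^{p_k}+b_k|u_k/\eta|^{p_k})\le1\}$. The limsup as $(k,t)\to(+\infty,0^+)$ (resp. $(-\infty,0^+)$) is the joint upper limit: $\lim_{N\to\infty}$ of the supremum over all integers $k\ge N$ (resp. $k\le -N$) and reals $0<t<1/N$. *)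

theory Defs
  imports "HOL-Analysis.Analysis"
begin

definition bdiff :: "(int \<Rightarrow> real) \<Rightarrow> int \<Rightarrow> real"  (\<open>\<nabla>\<^sup>-\<close>) where
  "\<nabla>\<^sup>- u k = u k - u (k - 1)"

definition fdiff :: "(int \<Rightarrow> real) \<Rightarrow> int \<Rightarrow> real"  (\<open>\<nabla>\<^sup>+\<close>) where
  "\<nabla>\<^sup>+ u k = u (k + 1) - u k"

text \<open>The map \<open>x \<mapsto> |x|\<^bsup>q-2\<^esup> x\<close>; it vanishes at \<open>0\<close>, also for \<open>q < 2\<close>, since \<open>0 powr r = 0\<close>.\<close>

definition signed_pow :: "real \<Rightarrow> real \<Rightarrow> real" where
  "signed_pow q x = \<bar>x\<bar> powr (q - 2) * x"

definition lp_var :: "(int \<Rightarrow> real) \<Rightarrow> (int \<Rightarrow> real) set" where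
  "lp_var p = {u. (\<lambda>k. \<bar>u k\<bar> powr p k) summable_on UNIV}"

definition energy_term ::
    "(int \<Rightarrow> real) \<Rightarrow> (int \<Rightarrow> real) \<Rightarrow> (int \<Rightarrow> real) \<Rightarrow> (int \<Rightarrow> real) \<Rightarrow> int \<Rightarrow> real" where
  "energy_term p a b u k = a k * \<bar>\<nabla>\<^sup>+ u k\<bar> powr p k + b k * \<bar>u k\<bar> powr p k"

definition E_space ::
    "(int \<Rightarrow> real) \<Rightarrow> (int \<Rightarrow> real) \<Rightarrow> (int \<Rightarrow> real) \<Rightarrow> (int \<Rightarrow> real) set" where
  "E_space p a b = {u \<in> lp_var p. energy_term p a b u summable_on UNIV}"

text \<open>Luxemburg norm. Summability is required explicitly because \<open>infsum\<close> is \<open>0\<close> on families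
  that are not summable. Differences are linear, so \<open>\<nabla>\<^sup>+ (u/\<eta>) = (\<nabla>\<^sup>+ u)/\<eta>\<close>.\<close>

definition E_norm ::
    "(int \<Rightarrow> real) \<Rightarrow> (int \<Rightarrow> real) \<Rightarrow> (int \<Rightarrow> real) \<Rightarrow> (int \<Rightarrow> real) \<Rightarrow> real" where
  "E_norm p a b u = Inf {\<eta>. \<eta> > 0 \<and>
     energy_term p a b (\<lambda>j. u j / \<eta>) summable_on UNIV \<and>
     (\<Sum>\<^sub>\<infinity>k. energy_term p a b (\<lambda>j. u j / \<eta>) k) \<le> 1}"

definition primitive :: "(int \<Rightarrow> real \<Rightarrow> real) \<Rightarrow> int \<Rightarrow> real \<Rightarrow> real" where
  "primitive f k t = (LBINT s=0..t. f k s)"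

definition homoclinic_solution ::
    "(int \<Rightarrow> real) \<Rightarrow> (int \<Rightarrow> real) \<Rightarrow> (int \<Rightarrow> real) \<Rightarrow> (int \<Rightarrow> real \<Rightarrow> real) \<Rightarrow> (int \<Rightarrow> real) \<Rightarrow> bool" where
  "homoclinic_solution p a b f u \<longleftrightarrow>
     (\<forall>k. - \<nabla>\<^sup>- (\<lambda>j. a j * signed_pow (p j) (\<nabla>\<^sup>+ u j)) k + b k * signed_pow (p k) (u k)
            = f k (u k)) \<and>
     (u \<longlongrightarrow> 0) at_top \<and> (u \<longlongrightarrow> 0) at_bot"

definition F_quotient ::
    "(int \<Rightarrow> real) \<Rightarrow> (int \<Rightarrow> real) \<Rightarrow> (int \<Rightarrow> real \<Rightarrow> real) \<Rightarrow> real \<Rightarrow> int \<Rightarrow> real \<Rightarrow> ereal" where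
  "F_quotient a b f q k t = ereal (primitive f k t / ((a (k - 1) + a k + b k) * t powr q))"

definition limsup_plus :: "(int \<Rightarrow> real \<Rightarrow> ereal) \<Rightarrow> ereal" where
  "limsup_plus g = Limsup (at_top \<times>\<^sub>F at_right 0) (\<lambda>(k, t). g k t)"

definition limsup_minus :: "(int \<Rightarrow> real \<Rightarrow> ereal) \<Rightarrow> ereal" where
  "limsup_minus g = Limsup (at_bot \<times>\<^sub>F at_right 0) (\<lambda>(k, t). g k t)"

text \<open>Agreement of these filter limits with the limits of suprema over
  \<open>k \<ge> N, 0 < t < 1/N\<close> and \<open>k \<le> -N, 0 < t < 1/N\<close>.\<close>

lemma SUP_tendsto_Limsup:
  fixes h :: "'a \<Rightarrow> ereal"
  assumes ev: "\<forall>\<^sub>F N in sequentially. \<forall>\<^sub>F x in \<F>. x \<in> A N"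
    and basis: "\<And>P. eventually P \<F> \<Longrightarrow> \<forall>\<^sub>F N in sequentially. \<forall>x\<in>A N. P x"
  shows "(\<lambda>N. SUP x\<in>A N. h x) \<longlonglongrightarrow> Limsup \<F> h"
proof (rule order_tendstoI)
  fix y assume y: "y < Limsup \<F> h"
  show "\<forall>\<^sub>F N in sequentially. y < (SUP x\<in>A N. h x)"
    using ev
  proof (rule eventually_mono)
    fix N assume N: "\<forall>\<^sub>F x in \<F>. x \<in> A N"
    have "Limsup \<F> h \<le> (SUP x\<in>A N. h x)"
      by (rule Limsup_bounded) (use N in \<open>auto elim!: eventually_mono intro: SUP_upper\<close>)
    then show "y < (SUP x\<in>A N. h x)" using y by simp
  qed
next
  fix y assume "Limsup \<F> h < y"
  then obtain P where P: "eventually P \<F>" "(SUP x\<in>Collect P. h x) < y"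
    by (auto simp: Limsup_def INF_less_iff)
  show "\<forall>\<^sub>F N in sequentially. (SUP x\<in>A N. h x) < y"
    using basis[OF P(1)]
  proof (rule eventually_mono)
    fix N assume "\<forall>x\<in>A N. P x"
    then have "(SUP x\<in>A N. h x) \<le> (SUP x\<in>Collect P. h x)"
      by (intro SUP_subset_mono) auto
    then show "(SUP x\<in>A N. h x) < y" using P(2) by simp
  qed
qed

lemma eventually_lt_at_right_0: "\<forall>\<^sub>F t in at_right 0. t \<in> {0<..<1 / real N}" if "N > 0"
  using that eventually_at_right_real[of 0 "1 / real N"] by simp

lemma eventually_at_right_0_basis:
  assumes "eventually P (at_right (0::real))"
  shows "\<forall>\<^sub>F N in sequentially. \<forall>t\<in>{0<..<1 / real N}. P t"
proof -
  obtain d where d: "d > 0" "\<And>t. 0 < t \<Longrightarrow> t < d \<Longrightarrow> P t"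
    using assms by (auto simp: eventually_at_right_field)
  have "\<forall>\<^sub>F N in sequentially. 1 / real N < d"
    using order_tendstoD(2)[OF lim_1_over_n d(1)] by simp
  then show ?thesis by (rule eventually_mono) (use d in auto)
qed

lemma SUP_tendsto_limsup_plus:
  "(\<lambda>N. SUP (k, t)\<in>{int N..} \<times> {0<..<1 / real N}. g k t) \<longlonglongrightarrow> limsup_plus g"
  unfolding limsup_plus_def
proof (rule SUP_tendsto_Limsup)
  show "\<forall>\<^sub>F N in sequentially. \<forall>\<^sub>F x in at_top \<times>\<^sub>F at_right 0. x \<in> {int N..} \<times> {0<..<1 / real N}"
    using eventually_gt_at_top[of 0]
  proof (rule eventually_mono)
    fix N :: nat assume "0 < N"
    then show "\<forall>\<^sub>F x in at_top \<times>\<^sub>F at_right 0. x \<in> {int N..} \<times> {0<..<1 / real N}"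
      using eventually_prodI[OF eventually_ge_at_top[of "int N"] eventually_lt_at_right_0[of N]]
      by (auto elim!: eventually_mono)
  qed
next
  fix P :: "int \<times> real \<Rightarrow> bool" assume "eventually P (at_top \<times>\<^sub>F at_right 0)"
  then obtain Q R where QR: "eventually Q at_top" "eventually R (at_right 0)"
    "\<And>k t. Q k \<Longrightarrow> R t \<Longrightarrow> P (k, t)"
    by (auto simp: eventually_prod_filter)
  obtain m where m: "\<And>k. k \<ge> m \<Longrightarrow> Q k" using QR(1) by (auto simp: eventually_at_top_linorder)
  show "\<forall>\<^sub>F N in sequentially. \<forall>x\<in>{int N..} \<times> {0<..<1 / real N}. P x"
    using eventually_at_right_0_basis[OF QR(2)] eventually_ge_at_top[of "nat m"]
    by eventually_elim (use QR(3) m in auto)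
qed

lemma SUP_tendsto_limsup_minus:
  "(\<lambda>N. SUP (k, t)\<in>{..- int N} \<times> {0<..<1 / real N}. g k t) \<longlonglongrightarrow> limsup_minus g"
  unfolding limsup_minus_def
proof (rule SUP_tendsto_Limsup)
  show "\<forall>\<^sub>F N in sequentially. \<forall>\<^sub>F x in at_bot \<times>\<^sub>F at_right 0. x \<in> {..- int N} \<times> {0<..<1 / real N}"
    using eventually_gt_at_top[of 0]
  proof (rule eventually_mono)
    fix N :: nat assume "0 < N"
    then show "\<forall>\<^sub>F x in at_bot \<times>\<^sub>F at_right 0. x \<in> {..- int N} \<times> {0<..<1 / real N}"
      using eventually_prodI[OF eventually_le_at_bot[of "- int N"] eventually_lt_at_right_0[of N]]
      by (auto elim!: eventually_mono)
  qed
next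
  fix P :: "int \<times> real \<Rightarrow> bool" assume "eventually P (at_bot \<times>\<^sub>F at_right 0)"
  then obtain Q R where QR: "eventually Q at_bot" "eventually R (at_right 0)"
    "\<And>k t. Q k \<Longrightarrow> R t \<Longrightarrow> P (k, t)"
    by (auto simp: eventually_prod_filter)
  obtain m where m: "\<And>k. k \<le> m \<Longrightarrow> Q k" using QR(1) by (auto simp: eventually_at_bot_linorder)
  show "\<forall>\<^sub>F N in sequentially. \<forall>x\<in>{..- int N} \<times> {0<..<1 / real N}. P x"
    using eventually_at_right_0_basis[OF QR(2)] eventually_ge_at_top[of "nat (- m)"]
    by eventually_elim (use QR(3) m in auto)
qed

end

(* For each n, minimise the energy functional J over the finite-energy sequences with values in
   [0, d_n]; the box is compact in the product topology and J is lower semicontinuous (Fatou for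
   the energy, a Weierstrass majorant for the potential).  Truncation at c_n shows that a minimiser
   stays below c_n < d_n, the growth condition makes J negative at some sequence supported on one
   site, so the minimiser is nonzero, and a one-sided derivative test at 0 makes it positive.  Hence
   it is interior in every coordinate and solves the equation.  Negativity of J bounds its energy
   by a multiple of d_n. *)
theory Submission
  imports Defs
begin

section \<open>Infinite sums, powers, and sequences indexed by the integers\<close>

text \<open>The difference \<open>h - g\<close> has finite support, so it sums to its finite sum;
  adding the sum of \<open>g\<close> gives the claim.\<close>

lemma has_sum_change_finite:
  fixes g h :: "'a \<Rightarrow> real"
  assumes "g summable_on UNIV" "finite S" "\<And>x. x \<notin> S \<Longrightarrow> h x = g x"
  shows "(h has_sum (infsum g UNIV + (\<Sum>x\<in>S. h x - g x))) UNIV"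
proof -
  have "((\<lambda>x. h x - g x) has_sum (\<Sum>x\<in>S. h x - g x)) UNIV"
    by (rule has_sum_finite_neutralI) (use assms in auto)
  from has_sum_add[OF has_sum_infsum[OF assms(1)] this] show ?thesis by simp
qed

text \<open>Lowering \<open>g\<close> at the single point \<open>z\<close> to \<open>h z\<close>
  gives a family that still dominates \<open>h\<close> and whose sum is smaller by exactly
  \<open>g z - h z\<close>.\<close>

lemma infsum_less_at:
  fixes g h :: "'a \<Rightarrow> real"
  assumes "g summable_on UNIV" "h summable_on UNIV" "\<And>x. h x \<le> g x" "h z < g z"
  shows "infsum h UNIV < infsum g UNIV"
proof -
  have s: "((g(z := h z)) has_sum (infsum g UNIV + (h z - g z))) UNIV"
    using has_sum_change_finite[OF assms(1), of "{z}" "g(z := h z)"] by simp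
  have "infsum h UNIV \<le> infsum g UNIV + (h z - g z)"
    by (rule has_sum_mono[OF has_sum_infsum[OF assms(2)] s]) (use assms in auto)
  then show ?thesis using assms by simp
qed

lemma has_real_derivative_abs_powr:
  fixes q x :: real
  assumes q: "1 < q"
  shows "((\<lambda>x. \<bar>x\<bar> powr q) has_real_derivative q * signed_pow q x) (at x)"
proof -
  consider "x > 0" | "x < 0" | "x = 0" by linarith
  then show ?thesis
  proof cases
    case 1
    have "((\<lambda>x. x powr q) has_real_derivative q * signed_pow q x) (at x)"
      using 1 powr_add[of x "q - 2" 1]
      by (auto intro!: derivative_eq_intros simp: signed_pow_def)
    then show ?thesis
      by (rule has_field_derivative_transform_within_open[of _ _ _ "{0<..}"]) (use 1 in auto)
  next
    case 2
    have "((\<lambda>x. (- x) powr q) has_real_derivative q * signed_pow q x) (at x)"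
      using 2 powr_add[of "- x" "q - 2" 1]
      by (auto intro!: derivative_eq_intros simp: signed_pow_def)
    then show ?thesis
      by (rule has_field_derivative_transform_within_open[of _ _ _ "{..<0}"]) (use 2 in auto)
  next
    case 3
    \<comment> \<open>At 0 the difference quotient has absolute value at most
      \<open>\<bar>h\<bar> powr (q - 1)\<close>, which tends to 0 because
      \<open>q > 1\<close>.\<close>
    have "((\<lambda>h. \<bar>h\<bar> powr (q - 1)) \<longlongrightarrow> 0) (at (0::real))"
      using q by (auto intro!: tendsto_eq_intros)
    then have "((\<lambda>h. \<bar>h\<bar> powr q / h) \<longlongrightarrow> 0) (at (0::real))"
    proof (rule Lim_null_comparison[rotated])
      show "\<forall>\<^sub>F h in at (0::real). norm (\<bar>h\<bar> powr q / h) \<le> \<bar>h\<bar> powr (q - 1)"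
        by (auto simp: powr_diff eventually_at_filter abs_divide)
    qed
    then show ?thesis using q 3 by (simp add: DERIV_def signed_pow_def)
  qed
qed

lemma continuous_on_abs_powr: "1 < q \<Longrightarrow> continuous_on A (\<lambda>x. \<bar>x\<bar> powr q)" for q :: real
  by (rule continuous_at_imp_continuous_on) (blast intro: DERIV_isCont has_real_derivative_abs_powr)

lemma signed_pow_0 [simp]: "signed_pow q 0 = 0"
  by (simp add: signed_pow_def)

lemma signed_pow_nonneg: "0 \<le> x \<Longrightarrow> 0 \<le> signed_pow q x"
  by (simp add: signed_pow_def)

lemma signed_pow_minus: "signed_pow q (- x) = - signed_pow q x"
  by (simp add: signed_pow_def)

lemma signed_pow_eq_0_iff [simp]: "signed_pow q x = 0 \<longleftrightarrow> x = 0"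
  by (simp add: signed_pow_def)

lemma int_eq_zero_propagate:
  fixes u :: "int \<Rightarrow> real"
  assumes "u k0 = 0" "\<And>k. u k = 0 \<Longrightarrow> u (k - 1) = 0 \<and> u (k + 1) = 0"
  shows "u k = 0"
  by (induction k rule: int_induct[of _ k0]) (use assms in auto)

text \<open>Outside a bounded range of indices \<open>b\<close> is at least 1, and the finitely many
  remaining values are positive, so a minimum over a finite set serves as the bound.\<close>

lemma bounded_below_of_coercive:
  fixes b :: "int \<Rightarrow> real"
  assumes "filterlim b at_top at_top" "filterlim b at_top at_bot" "\<And>k. b k > 0"
  obtains \<beta> where "\<beta> > 0" "\<And>k. \<beta> \<le> b k"
proof -
  obtain m n where m: "\<And>k. k \<ge> m \<Longrightarrow> 1 \<le> b k" and n: "\<And>k. k \<le> n \<Longrightarrow> 1 \<le> b k"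
    using assms(1,2)
    unfolding filterlim_at_top eventually_at_top_linorder eventually_at_bot_linorder by metis
  let ?B = "insert 1 (b ` {n..m})"
  have fin: "finite ?B" by simp
  have "Min ?B > 0" using assms(3) by (subst Min_gr_iff) auto
  moreover have "Min ?B \<le> b k" for k
  proof (cases "n \<le> k \<and> k \<le> m")
    case True
    then show ?thesis by (intro Min_le) auto
  next
    case False
    then have "1 \<le> b k" using m[of k] n[of k] by force
    moreover have "Min ?B \<le> 1" by (intro Min_le) auto
    ultimately show ?thesis by linarith
  qed
  ultimately show ?thesis by (rule that)
qed

section \<open>The energy functional on boxes\<close>

text \<open>Here \<open>q\<close> stands for the infimum of the exponents and \<open>P\<close> for
  any upper bound; only the inequalities between them and \<open>p k\<close> enter.\<close>

locale discrete_problem =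
  fixes p a b :: "int \<Rightarrow> real" and f :: "int \<Rightarrow> real \<Rightarrow> real" and q P :: real
  assumes q_gt_1: "1 < q"
    and p_ge: "\<And>k. q \<le> p k"
    and p_le: "\<And>k. p k \<le> P"
    and a_pos: "\<And>k. a k > 0"
    and b_pos: "\<And>k. b k > 0"
    and f_cont: "\<And>k. continuous_on UNIV (f k)"
    and b_at_top: "filterlim b at_top at_top"
    and b_at_bot: "filterlim b at_top at_bot"
    and f_0: "\<And>k. f k 0 = 0"
    and f_sup_summable: "\<And>T. T > 0 \<Longrightarrow> (\<lambda>k. SUP t\<in>{-T..T}. \<bar>f k t\<bar>) summable_on UNIV"
begin

abbreviation F :: "int \<Rightarrow> real \<Rightarrow> real" where
  "F \<equiv> primitive f"

definition M :: "real \<Rightarrow> int \<Rightarrow> real" where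
  "M T k = (SUP t\<in>{-T..T}. \<bar>f k t\<bar>)"

text \<open>Dividing the weights by \<open>p k\<close> cancels the factor produced by
  differentiating the powers, so the variation of \<open>D\<close> gives the left side of the
  equation.\<close>

definition D :: "(int \<Rightarrow> real) \<Rightarrow> int \<Rightarrow> real" where
  "D = energy_term p (\<lambda>k. a k / p k) (\<lambda>k. b k / p k)"

definition J :: "(int \<Rightarrow> real) \<Rightarrow> real" where
  "J u = (\<Sum>\<^sub>\<infinity>k. D u k - F k (u k))"

definition box :: "real \<Rightarrow> (int \<Rightarrow> real) set" where
  "box d = {u. \<forall>k. u k \<in> {0..d}}"

text \<open>Finite energy is demanded because \<open>infsum\<close> is 0 on a non-summable family,
  which would make \<open>J\<close> meaningless as an energy.\<close>

definition W :: "real \<Rightarrow> (int \<Rightarrow> real) set" where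
  "W d = {u \<in> box d. D u summable_on UNIV}"

lemma p_gt_1: "1 < p k"
  using q_gt_1 p_ge[of k] by linarith

lemma p_pos: "0 < p k"
  using p_gt_1[of k] by linarith

lemma P_pos: "0 < P"
  using p_pos[of 0] p_le[of 0] by linarith

lemma F_deriv: "(F k has_real_derivative f k t) (at t)"
proof -
  \<comment> \<open>With this \<open>A\<close> both 0 and \<open>t\<close> are interior to
    \<open>{-A..A}\<close>, so the derivative within the interval is a two-sided one.\<close>
  define A where "A = \<bar>t\<bar> + 1"
  have "((\<lambda>u. LBINT y=ereal 0..ereal u. f k y) has_vector_derivative f k t) (at t within {-A..A})"
    by (rule interval_integral_FTC2)
      (auto simp: A_def intro: continuous_on_subset[OF f_cont])
  moreover have "at t within {-A..A} = at t"
    by (rule at_within_interior) (auto simp: A_def)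
  ultimately show ?thesis
    by (simp add: has_real_derivative_iff_has_vector_derivative primitive_def[abs_def] zero_ereal_def)
qed

lemma F_0 [simp]: "F k 0 = 0"
  by (simp add: primitive_def zero_ereal_def)

lemma F_continuous: "continuous_on A (F k)"
  by (meson DERIV_continuous F_deriv continuous_at_imp_continuous_on)

lemma f_le_M: "\<bar>f k t\<bar> \<le> M T k" if "\<bar>t\<bar> \<le> T"
  unfolding M_def
proof (rule cSUP_upper)
  have "compact ((\<lambda>t. \<bar>f k t\<bar>) ` {-T..T})"
    by (intro compact_continuous_image continuous_intros continuous_on_subset[OF f_cont]) auto
  then show "bdd_above ((\<lambda>t. \<bar>f k t\<bar>) ` {-T..T})"
    by (simp add: bounded_imp_bdd_above compact_imp_bounded)
qed (use that in auto)

lemma M_nonneg: "0 \<le> M T k" if "0 \<le> T"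
  using f_le_M[of 0 T k] that by simp

text \<open>By the mean value theorem \<open>F k t\<close> equals \<open>t * f k z\<close> for some
  \<open>z\<close> between 0 and \<open>t\<close>. The factor \<open>t\<close> is what later makes
  the energies small.\<close>

lemma F_bound: "\<bar>F k t\<bar> \<le> t * M T k" if "0 \<le> t" "t \<le> T"
proof (cases "t = 0")
  case False
  then have "0 < t" using that by simp
  then obtain z where z: "0 < z" "z < t" "F k t - F k 0 = (t - 0) * f k z"
    using MVT2[of 0 t "F k" "f k"] F_deriv by blast
  have "\<bar>f k z\<bar> \<le> M T k" using z that by (intro f_le_M) auto
  then show ?thesis using z \<open>0 < t\<close> by (simp add: abs_mult)
qed simp

lemma F_bound_box: "\<bar>F k (u k)\<bar> \<le> d * M T k" if "u \<in> box d" "d \<le> T"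
proof -
  have "\<bar>F k (u k)\<bar> \<le> u k * M T k"
    using that by (intro F_bound) (auto simp: box_def intro: order_trans)
  also have "\<dots> \<le> d * M T k"
    using that by (intro mult_right_mono M_nonneg) (auto simp: box_def intro: order_trans)
  finally show ?thesis .
qed

lemma M_summable: "0 < T \<Longrightarrow> M T summable_on UNIV"
  using f_sup_summable by (simp add: M_def[abs_def])

lemma F_summable: "(\<lambda>k. F k (u k)) summable_on UNIV" if "u \<in> box d" "0 < d"
proof (rule abs_summable_summable, rule summable_on_comparison_test)
  show "(\<lambda>k. d * M d k) summable_on UNIV"
    by (intro summable_on_cmult_right M_summable that)
qed (use F_bound_box[OF that(1)] in auto)

lemma D_nonneg: "0 \<le> D u k"
  using less_imp_le[OF a_pos] less_imp_le[OF b_pos] less_imp_le[OF p_pos]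
  by (auto simp: D_def energy_term_def)

lemma J_has_sum:
  assumes "u \<in> W d" "0 < d"
  shows "((\<lambda>k. D u k - F k (u k)) has_sum (infsum (D u) UNIV - (\<Sum>\<^sub>\<infinity>k. F k (u k)))) UNIV"
proof -
  have "(D u has_sum infsum (D u) UNIV) UNIV"
    "((\<lambda>k. F k (u k)) has_sum (\<Sum>\<^sub>\<infinity>k. F k (u k))) UNIV"
    using assms by (auto simp: W_def intro!: has_sum_infsum F_summable)
  from has_sum_add[OF this(1) has_sum_uminusI[OF this(2)]] show ?thesis by simp
qed

lemma J_summable: "(\<lambda>k. D u k - F k (u k)) summable_on UNIV" if "u \<in> W d" "0 < d"
  using J_has_sum[OF that] by (rule has_sum_imp_summable)

lemma J_eq: "J u = infsum (D u) UNIV - (\<Sum>\<^sub>\<infinity>k. F k (u k))" if "u \<in> W d" "0 < d"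
  unfolding J_def by (rule infsumI[OF J_has_sum[OF that]])

lemma zero_in_W: "0 \<le> d \<Longrightarrow> (\<lambda>_. 0) \<in> W d"
  by (simp add: W_def box_def D_def energy_term_def[abs_def] fdiff_def)

lemma J_zero: "J (\<lambda>_. 0) = 0"
  by (simp add: J_def D_def energy_term_def fdiff_def)

section \<open>Variation of a single coordinate\<close>

text \<open>The part of the functional that depends on the single coordinate \<open>u k = t\<close>.\<close>

definition slice :: "(int \<Rightarrow> real) \<Rightarrow> int \<Rightarrow> real \<Rightarrow> real" where
  "slice u k t = a (k - 1) / p (k - 1) * \<bar>t - u (k - 1)\<bar> powr p (k - 1)
     + a k / p k * \<bar>u (k + 1) - t\<bar> powr p k + b k / p k * \<bar>t\<bar> powr p k - F k t"

definition slice_deriv :: "(int \<Rightarrow> real) \<Rightarrow> int \<Rightarrow> real \<Rightarrow> real" where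
  "slice_deriv u k t = a (k - 1) * signed_pow (p (k - 1)) (t - u (k - 1))
     - a k * signed_pow (p k) (u (k + 1) - t) + b k * signed_pow (p k) t - f k t"

lemma slice_has_derivative: "(slice u k has_real_derivative slice_deriv u k t) (at t)"
proof -
  have d1: "((\<lambda>t. \<bar>t - u (k - 1)\<bar> powr p (k - 1)) has_real_derivative
      (p (k - 1) * signed_pow (p (k - 1)) (t - u (k - 1))) * (1 - 0)) (at t)"
    by (rule DERIV_chain2[OF has_real_derivative_abs_powr[OF p_gt_1]])
      (auto intro!: derivative_eq_intros)
  have d2: "((\<lambda>t. \<bar>u (k + 1) - t\<bar> powr p k) has_real_derivative
      (p k * signed_pow (p k) (u (k + 1) - t)) * (0 - 1)) (at t)"
    by (rule DERIV_chain2[OF has_real_derivative_abs_powr[OF p_gt_1]])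
      (auto intro!: derivative_eq_intros)
  have d3: "((\<lambda>t. \<bar>t\<bar> powr p k) has_real_derivative p k * signed_pow (p k) t) (at t)"
    by (rule has_real_derivative_abs_powr[OF p_gt_1])
  have "((\<lambda>t. slice u k t) has_real_derivative
      a (k - 1) / p (k - 1) * ((p (k - 1) * signed_pow (p (k - 1)) (t - u (k - 1))) * (1 - 0))
      + a k / p k * ((p k * signed_pow (p k) (u (k + 1) - t)) * (0 - 1))
      + b k / p k * (p k * signed_pow (p k) t) - f k t) (at t)"
    unfolding slice_def by (intro DERIV_diff DERIV_add DERIV_cmult d1 d2 d3 F_deriv)
  moreover have "a (k - 1) / p (k - 1) * ((p (k - 1) * signed_pow (p (k - 1)) (t - u (k - 1))) * (1 - 0))
      + a k / p k * ((p k * signed_pow (p k) (u (k + 1) - t)) * (0 - 1))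
      + b k / p k * (p k * signed_pow (p k) t) - f k t = slice_deriv u k t"
    using p_pos[of k] p_pos[of "k - 1"] by (simp add: slice_deriv_def)
  ultimately show ?thesis by simp
qed

lemma W_update:
  assumes u: "u \<in> W d" and t: "0 \<le> t" "t \<le> d" and d: "0 < d"
  shows "u(k := t) \<in> W d" "J (u(k := t)) = J u + slice u k t - slice u k (u k)"
proof -
  let ?v = "u(k := t)"
  \<comment> \<open>The value at \<open>k\<close> enters the forward differences at
    \<open>k - 1\<close> and \<open>k\<close> only, so just these two terms of the sum
    change.\<close>
  have same: "D ?v j = D u j" if "j \<notin> {k - 1, k}" for j
    using that by (simp add: D_def energy_term_def fdiff_def)
  have "D ?v summable_on UNIV"
    using has_sum_change_finite[of "D u" "{k - 1, k}" "D ?v"] same u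
    by (auto simp: W_def summable_on_def)
  then show W: "?v \<in> W d"
    using u t by (auto simp: W_def box_def)
  have "J ?v = J u + (\<Sum>j\<in>{k - 1, k}. (D ?v j - F j (?v j)) - (D u j - F j (u j)))"
    unfolding J_def
    by (rule infsumI, rule has_sum_change_finite[OF J_summable[OF u d]]) (use same in auto)
  also have "(\<Sum>j\<in>{k - 1, k}. (D ?v j - F j (?v j)) - (D u j - F j (u j)))
      = slice u k t - slice u k (u k)"
    by (simp add: D_def energy_term_def fdiff_def slice_def)
  finally show "J ?v = J u + slice u k t - slice u k (u k)" by (simp only: add_diff_eq)
qed

section \<open>Existence of minimisers\<close>

text \<open>Tychonoff's theorem, since the topology on functions is the product topology.\<close>

lemma compact_box: "compact (box d)"
proof -
  have "compactin (product_topology (\<lambda>i::int. euclidean) UNIV) (PiE UNIV (\<lambda>i. {0..d::real}))"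
    by (subst compactin_PiE) simp
  moreover have "PiE UNIV (\<lambda>i. {0..d}) = box d"
    by (auto simp: box_def PiE_def Pi_def)
  ultimately show ?thesis by (simp add: euclidean_product_topology)
qed

text \<open>Each finite partial sum depends continuously on finitely many coordinates, and the
  summable majorant \<open>d * M d k\<close> makes the convergence uniform on the box.\<close>

lemma potential_continuous: "continuous_on (box d) (\<lambda>u. \<Sum>\<^sub>\<infinity>k. F k (u k))" if "0 < d"
proof (rule uniform_limit_theorem)
  show "uniform_limit (box d) (\<lambda>S u. \<Sum>k\<in>S. F k (u k)) (\<lambda>u. \<Sum>\<^sub>\<infinity>k. F k (u k))
      (finite_subsets_at_top UNIV)"
    by (rule Weierstrass_m_test_general[where M = "\<lambda>k. d * M d k"])
      (use F_bound_box that in \<open>auto intro!: summable_on_cmult_right M_summable\<close>)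
  show "\<forall>\<^sub>F S in finite_subsets_at_top UNIV. continuous_on (box d) (\<lambda>u. \<Sum>k\<in>S. F k (u k))"
    by (intro always_eventually allI continuous_on_sum
        continuous_on_compose2[OF F_continuous[of UNIV]]
        continuous_on_subset[OF continuous_on_product_coordinates]) auto
qed simp

lemma D_continuous: "continuous_on UNIV (\<lambda>u. D u k)"
  unfolding D_def energy_term_def fdiff_def
  by (intro continuous_intros continuous_on_product_coordinates
      continuous_on_compose2[OF continuous_on_abs_powr[OF p_gt_1, of UNIV]]) auto

lemma minimizer_exists:
  assumes d: "0 < d"
  obtains u where "u \<in> W d" "\<And>v. v \<in> W d \<Longrightarrow> J u \<le> J v"
proof -
  let ?\<Psi> = "\<lambda>u. \<Sum>\<^sub>\<infinity>k. F k (u k)"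
  have lower: "(\<Sum>\<^sub>\<infinity>k. - (d * M d k)) \<le> J u" if u: "u \<in> W d" for u
    unfolding J_def
  proof (rule infsum_mono)
    show "(\<lambda>k. - (d * M d k)) summable_on UNIV"
      by (intro summable_on_uminus[THEN iffD2] summable_on_cmult_right M_summable d)
    show "(\<lambda>k. D u k - F k (u k)) summable_on UNIV" by (rule J_summable[OF u d])
    show "- (d * M d k) \<le> D u k - F k (u k)" for k
      using D_nonneg[of u k] F_bound_box[of u d d k] u by (auto simp: W_def)
  qed
  define m where "m = Inf (J ` W d)"
  have ne: "J ` W d \<noteq> {}" using zero_in_W[of d] d by auto
  have bdd: "bdd_below (J ` W d)" using lower by (auto intro!: bdd_belowI2)
  have m_le: "m \<le> J v" if "v \<in> W d" for v
    unfolding m_def using that bdd by (auto intro: cINF_lower)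
  have "\<exists>w\<in>W d. J w < m + inverse (real (Suc j))" for j
    using cInf_lessD[OF ne, of "m + inverse (real (Suc j))"] by (auto simp: m_def)
  then obtain w where w: "\<And>j. w j \<in> W d" "\<And>j. J (w j) < m + inverse (real (Suc j))"
    by metis
  have "\<forall>j. w j \<in> box d" using w by (auto simp: W_def)
  \<comment> \<open>The integers are countable, so the product topology is metrizable and
    compactness yields a convergent subsequence.\<close>
  then obtain u r where ur: "u \<in> box d" "strict_mono r" "(w \<circ> r) \<longlonglongrightarrow> u"
    using compact_box[of d, unfolded compact_eq_seq_compact_metric seq_compact_def] by metis
  have \<Psi>lim: "(\<lambda>j. ?\<Psi> ((w \<circ> r) j)) \<longlonglongrightarrow> ?\<Psi> u"
    by (rule continuous_on_tendsto_compose[OF potential_continuous[OF d] ur(3) ur(1)])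
      (use w in \<open>auto simp: W_def\<close>)
  \<comment> \<open>Fatou's lemma by hand: a finite partial sum of \<open>D\<close> is continuous
    and at most \<open>J\<close> plus the potential along the subsequence, so the bound survives in
    the limit.\<close>
  have fatou: "sum (D u) S \<le> m + ?\<Psi> u" if S: "finite S" for S
  proof (rule LIMSEQ_le)
    show "(\<lambda>j. sum (D ((w \<circ> r) j)) S) \<longlonglongrightarrow> sum (D u) S"
      by (intro tendsto_sum continuous_on_tendsto_compose[OF D_continuous ur(3)]) auto
    have "(\<lambda>j. inverse (real (Suc (r j)))) \<longlonglongrightarrow> 0"
      using LIMSEQ_subseq_LIMSEQ[OF LIMSEQ_inverse_real_of_nat ur(2)] by (simp add: o_def)
    then have "(\<lambda>j. (m + inverse (real (Suc (r j)))) + ?\<Psi> ((w \<circ> r) j)) \<longlonglongrightarrow> (m + 0) + ?\<Psi> u"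
      by (intro tendsto_add tendsto_const \<Psi>lim)
    then show "(\<lambda>j. (m + inverse (real (Suc (r j)))) + ?\<Psi> ((w \<circ> r) j)) \<longlonglongrightarrow> m + ?\<Psi> u"
      by simp
    have "sum (D ((w \<circ> r) j)) S \<le> (m + inverse (real (Suc (r j)))) + ?\<Psi> ((w \<circ> r) j)" for j
    proof -
      have "sum (D (w (r j))) S \<le> infsum (D (w (r j))) UNIV"
        by (rule finite_sum_le_infsum) (use w S D_nonneg in \<open>auto simp: W_def\<close>)
      then show ?thesis using J_eq[OF w(1)[of "r j"] d] w(2)[of "r j"] by simp
    qed
    then show "\<exists>N. \<forall>n\<ge>N. sum (D ((w \<circ> r) n)) S
        \<le> (m + inverse (real (Suc (r n)))) + ?\<Psi> ((w \<circ> r) n)" by blast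
  qed
  have summ: "D u summable_on UNIV"
    by (rule nonneg_bdd_above_summable_on) (use fatou D_nonneg in \<open>auto intro!: bdd_aboveI2\<close>)
  then have uW: "u \<in> W d" using ur by (simp add: W_def)
  have "infsum (D u) UNIV \<le> m + ?\<Psi> u"
    by (rule infsum_le_finite_sums[OF summ]) (use fatou in auto)
  then have "J u \<le> m" using J_eq[OF uW d] by simp
  then show ?thesis using that[OF uW] m_le by fastforce
qed

section \<open>Minimisers avoid both obstacles\<close>

lemma F_antimono:
  assumes "\<And>t. t \<in> {c..d} \<Longrightarrow> f k t \<le> 0" "c \<le> t" "t \<le> d"
  shows "F k t \<le> F k c"
  by (rule DERIV_nonpos_imp_nonincreasing[OF assms(2)])
    (use F_deriv assms in \<open>auto intro!: exI[of _ "f k _"]\<close>)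

text \<open>Truncating at \<open>c\<close> strictly lowers the functional, because \<open>F k\<close> is nonincreasing on
  \<open>[c, d]\<close>; hence the upper obstacle \<open>d\<close> is never active.\<close>

lemma minimizer_le:
  assumes c: "0 < c" "c < d" and f_le: "\<And>k t. t \<in> {c..d} \<Longrightarrow> f k t \<le> 0"
    and u: "u \<in> W d" and min: "\<And>v. v \<in> W d \<Longrightarrow> J u \<le> J v"
  shows "u k \<le> c"
proof (rule ccontr)
  assume k: "\<not> u k \<le> c"
  define v where "v = (\<lambda>j. min (u j) c)"
  have d: "0 < d" using c by simp
  have u_box: "0 \<le> u j" "u j \<le> d" for j using u by (auto simp: W_def box_def)
  \<comment> \<open>Truncation is 1-Lipschitz, so it increases no difference; on nonnegative values
    it increases no modulus either.\<close>
  have Dle: "a j / p j * \<bar>\<nabla>\<^sup>+ v j\<bar> powr p j \<le> a j / p j * \<bar>\<nabla>\<^sup>+ u j\<bar> powr p j"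
    "b j / p j * \<bar>v j\<bar> powr p j \<le> b j / p j * \<bar>u j\<bar> powr p j" for j
    using a_pos[of j] b_pos[of j] p_pos[of j] u_box[of j] c
    by (intro mult_left_mono powr_mono2; simp add: v_def fdiff_def)+
  \<comment> \<open>The strict gain comes from the \<open>b\<close> term at the site
    \<open>k\<close> where \<open>u\<close> exceeds \<open>c\<close>.\<close>
  have strict: "b k / p k * \<bar>v k\<bar> powr p k < b k / p k * \<bar>u k\<bar> powr p k"
    using b_pos[of k] p_pos[of k] k c
    by (intro mult_strict_left_mono powr_less_mono2) (auto simp: v_def)
  have D_le: "D v j \<le> D u j" for j
    using Dle[of j] by (simp add: D_def energy_term_def)
  have F_le: "F j (u j) \<le> F j (v j)" for j
    using F_antimono[of c d j "u j"] f_le u_box[of j] by (auto simp: v_def min_def)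
  have "D v summable_on UNIV"
    by (rule summable_on_comparison_test[of "D u"]) (use u D_le D_nonneg in \<open>auto simp: W_def\<close>)
  then have v: "v \<in> W d"
    using u_box c by (auto simp: W_def box_def v_def min_def intro: order_trans)
  have "J v < J u"
    unfolding J_def
  proof (rule infsum_less_at[OF J_summable[OF u d] J_summable[OF v d]])
    show "D v j - F j (v j) \<le> D u j - F j (u j)" for j
      using D_le[of j] F_le[of j] by simp
    show "D v k - F k (v k) < D u k - F k (u k)"
      using Dle(1)[of k] strict F_le[of k] by (simp add: D_def energy_term_def)
  qed
  then show False using min[OF v] by simp
qed

lemma slice_minimal:
  assumes "u \<in> W d" "\<And>v. v \<in> W d \<Longrightarrow> J u \<le> J v" "0 \<le> t" "t \<le> d" "0 < d"
  shows "slice u k (u k) \<le> slice u k t"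
  using W_update[OF assms(1,3-5), of k] assms(2)[of "u(k := t)"] by simp

text \<open>If \<open>u k = 0\<close>, the one-sided derivative of the slice at \<open>0\<close> must be nonnegative, while it
  equals \<open>- a (k-1) |u (k-1)|\<^bsup>p (k-1) - 1\<^esup> - a k |u (k+1)|\<^bsup>p k - 1\<^esup>\<close>; so zeros propagate.\<close>

lemma minimizer_pos:
  assumes d: "0 < d" and u: "u \<in> W d" and min: "\<And>v. v \<in> W d \<Longrightarrow> J u \<le> J v"
    and nz: "u j \<noteq> 0"
  shows "0 < u k"
proof -
  have nonneg: "0 \<le> u i" for i using u by (auto simp: W_def box_def)
  have "u (k - 1) = 0 \<and> u (k + 1) = 0" if k: "u k = 0" for k
  proof -
    have "0 \<le> slice_deriv u k 0"
    proof (rule ccontr)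
      assume "\<not> 0 \<le> slice_deriv u k 0"
      then obtain e where e: "e > 0" "\<And>h. 0 < h \<Longrightarrow> h < e \<Longrightarrow> slice u k h < slice u k 0"
        using has_real_derivative_neg_dec_right[OF slice_has_derivative[of u k 0]] by auto
      \<comment> \<open>This point lies both in the interval where the slice is below its value at 0
        and within the obstacle \<open>d\<close>.\<close>
      have "slice u k (Min {e / 2, d}) < slice u k 0"
        using e(1) d by (intro e(2)) auto
      then show False
        using slice_minimal[OF u min _ _ d, of "Min {e / 2, d}" k] e(1) d k by simp
    qed
    then have "a (k - 1) * signed_pow (p (k - 1)) (u (k - 1))
        + a k * signed_pow (p k) (u (k + 1)) \<le> 0"
      by (simp add: slice_deriv_def f_0 signed_pow_minus)
    moreover have "0 \<le> a (k - 1) * signed_pow (p (k - 1)) (u (k - 1))"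
      "0 \<le> a k * signed_pow (p k) (u (k + 1))"
      by (intro mult_nonneg_nonneg signed_pow_nonneg less_imp_le[OF a_pos] nonneg)+
    ultimately have "a (k - 1) * signed_pow (p (k - 1)) (u (k - 1)) = 0"
      "a k * signed_pow (p k) (u (k + 1)) = 0" by linarith+
    then show ?thesis using a_pos[of k] a_pos[of "k - 1"] by simp
  qed
  then have "u k \<noteq> 0" using nz int_eq_zero_propagate[of u k j] by metis
  then show ?thesis using nonneg[of k] by simp
qed

text \<open>Small changes of \<open>u k\<close> in either direction stay admissible, so the slice
  has a local minimum there; the vanishing of its derivative is the equation at
  \<open>k\<close>.\<close>

lemma interior_minimizer_equation:
  assumes u: "u \<in> W d" and min: "\<And>v. v \<in> W d \<Longrightarrow> J u \<le> J v" and k: "0 < u k" "u k < d"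
  shows "- \<nabla>\<^sup>- (\<lambda>j. a j * signed_pow (p j) (\<nabla>\<^sup>+ u j)) k + b k * signed_pow (p k) (u k)
    = f k (u k)"
proof -
  have "slice_deriv u k (u k) = 0"
  proof (rule DERIV_local_min[OF slice_has_derivative])
    show "0 < Min {u k, d - u k}" using k by simp
    show "\<forall>t. \<bar>u k - t\<bar> < Min {u k, d - u k} \<longrightarrow> slice u k (u k) \<le> slice u k t"
      using k by (auto intro!: slice_minimal[OF u min])
  qed
  then show ?thesis by (simp add: slice_deriv_def bdiff_def fdiff_def)
qed

section \<open>Energy, decay at infinity and the Luxemburg norm\<close>

lemma energy_nonneg: "0 \<le> energy_term p a b u k"
  using a_pos[of k] b_pos[of k] by (simp add: energy_term_def)

lemma energy_le_D: "energy_term p a b u k \<le> P * D u k"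
proof -
  have "energy_term p a b u k = p k * D u k"
    using p_pos[of k] by (simp add: energy_term_def D_def field_simps)
  also have "\<dots> \<le> P * D u k" by (intro mult_right_mono p_le D_nonneg)
  finally show ?thesis .
qed

text \<open>A positive lower bound for \<open>b\<close> controls the powers of \<open>u\<close> by
  the energy, so finite energy already gives membership in \<open>lp_var p\<close>.\<close>

lemma in_E_space:
  assumes "energy_term p a b u summable_on UNIV"
  shows "u \<in> E_space p a b"
proof -
  obtain \<beta> where \<beta>: "\<beta> > 0" "\<And>k. \<beta> \<le> b k"
    using bounded_below_of_coercive[OF b_at_top b_at_bot b_pos] by blast
  have "(\<lambda>k. \<bar>u k\<bar> powr p k) summable_on UNIV"
  proof (rule summable_on_comparison_test)
    show "(\<lambda>k. inverse \<beta> * energy_term p a b u k) summable_on UNIV"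
      by (intro summable_on_cmult_right assms)
    show "\<bar>u k\<bar> powr p k \<le> inverse \<beta> * energy_term p a b u k" for k
    proof -
      have "\<beta> * \<bar>u k\<bar> powr p k \<le> b k * \<bar>u k\<bar> powr p k" by (intro mult_right_mono \<beta>) auto
      also have "\<dots> \<le> energy_term p a b u k" using a_pos[of k] by (simp add: energy_term_def)
      finally show ?thesis using \<beta>(1) by (simp add: field_simps)
    qed
  qed auto
  then show ?thesis using assms by (simp add: E_space_def lp_var_def)
qed

text \<open>Each \<open>b k * \<bar>u k\<bar> powr p k\<close> is at most the total energy, while
  \<open>b\<close> tends to infinity. The filter \<open>G\<close> covers both ends of the
  integers.\<close>

lemma tendsto_0_of_energy:
  assumes en: "energy_term p a b u summable_on UNIV" and b: "filterlim b at_top G"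
  shows "(u \<longlongrightarrow> 0) G"
proof (rule tendstoI)
  fix e :: real assume "e > 0"
  \<comment> \<open>Capping at 1 gives \<open>e' powr P \<le> e' powr p k\<close>, a lower bound
    uniform in the variable exponent.\<close>
  define e' where "e' = min e 1"
  have e': "0 < e'" "e' \<le> 1" "e' \<le> e" using \<open>e > 0\<close> by (auto simp: e'_def)
  let ?C = "infsum (energy_term p a b u) UNIV"
  have bound: "b k * \<bar>u k\<bar> powr p k \<le> ?C" for k
  proof -
    have "b k * \<bar>u k\<bar> powr p k \<le> energy_term p a b u k"
      using a_pos[of k] by (simp add: energy_term_def)
    also have "\<dots> \<le> ?C"
      using finite_sum_le_infsum[OF en, of "{k}"] energy_nonneg by auto
    finally show ?thesis .
  qed
  have "\<forall>\<^sub>F k in G. ?C / e' powr P < b k"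
    using b by (simp add: filterlim_at_top_dense)
  then show "\<forall>\<^sub>F k in G. dist (u k) 0 < e"
  proof (rule eventually_mono)
    fix k assume k: "?C / e' powr P < b k"
    show "dist (u k) 0 < e"
    proof (rule ccontr)
      assume "\<not> dist (u k) 0 < e"
      then have "e' \<le> \<bar>u k\<bar>" using e' by simp
      have "e' powr P \<le> e' powr p k"
        using e' p_le by (intro powr_mono') auto
      also have "\<dots> \<le> \<bar>u k\<bar> powr p k"
        using \<open>e' \<le> \<bar>u k\<bar>\<close> e' p_pos[of k] by (intro powr_mono2) auto
      finally have "b k * e' powr P \<le> b k * \<bar>u k\<bar> powr p k"
        using b_pos[of k] by (intro mult_left_mono) auto
      then show False using bound[of k] k e' by (simp add: field_simps)
    qed
  qed
qed

lemma energy_scale: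
  assumes \<eta>: "0 < \<eta>" "\<eta> \<le> 1"
  shows "energy_term p a b (\<lambda>j. u j / \<eta>) k \<le> energy_term p a b u k / \<eta> powr P"
proof -
  have "energy_term p a b (\<lambda>j. u j / \<eta>) k = energy_term p a b u k / \<eta> powr p k"
  proof -
    have "\<nabla>\<^sup>+ (\<lambda>j. u j / \<eta>) k = \<nabla>\<^sup>+ u k / \<eta>" by (simp add: fdiff_def diff_divide_distrib)
    then show ?thesis using \<eta> by (simp add: energy_term_def powr_divide add_divide_distrib)
  qed
  also have "\<dots> \<le> energy_term p a b u k / \<eta> powr P"
    using \<eta> energy_nonneg p_le by (intro divide_left_mono powr_mono' mult_pos_pos) auto
  finally show ?thesis .
qed

text \<open>Dividing by \<open>\<eta> \<le> 1\<close> multiplies the energy by at most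
  \<open>1 / \<eta> powr P\<close>, so \<open>\<eta>\<close> is admissible in the infimum. This also
  shows that the infimum is over a nonempty set.\<close>

lemma E_norm_bounds:
  assumes en: "energy_term p a b u summable_on UNIV"
    and \<eta>: "0 < \<eta>" "\<eta> \<le> 1" and le: "infsum (energy_term p a b u) UNIV \<le> \<eta> powr P"
  shows "0 \<le> E_norm p a b u" "E_norm p a b u \<le> \<eta>"
proof -
  let ?S = "{\<eta>. \<eta> > 0 \<and> energy_term p a b (\<lambda>j. u j / \<eta>) summable_on UNIV \<and>
     (\<Sum>\<^sub>\<infinity>k. energy_term p a b (\<lambda>j. u j / \<eta>) k) \<le> 1}"
  have s: "(\<lambda>k. inverse (\<eta> powr P) * energy_term p a b u k) summable_on UNIV"
    by (intro summable_on_cmult_right en)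
  have sc: "energy_term p a b (\<lambda>j. u j / \<eta>) k \<le> inverse (\<eta> powr P) * energy_term p a b u k" for k
    using energy_scale[OF \<eta>, of u k] by (simp add: field_simps)
  have s': "energy_term p a b (\<lambda>j. u j / \<eta>) summable_on UNIV"
    by (rule summable_on_comparison_test[OF s]) (use sc energy_nonneg in auto)
  have "(\<Sum>\<^sub>\<infinity>k. energy_term p a b (\<lambda>j. u j / \<eta>) k)
      \<le> (\<Sum>\<^sub>\<infinity>k. inverse (\<eta> powr P) * energy_term p a b u k)"
    by (rule infsum_mono[OF s' s]) (rule sc)
  also have "\<dots> = inverse (\<eta> powr P) * infsum (energy_term p a b u) UNIV"
    by (rule infsum_cmult_right) (use en in auto)
  also have "\<dots> \<le> 1" using le \<eta> by (simp add: field_simps)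
  finally have mem: "\<eta> \<in> ?S" using \<eta> s' by simp
  show "0 \<le> E_norm p a b u"
    unfolding E_norm_def using mem by (intro cInf_greatest) auto
  show "E_norm p a b u \<le> \<eta>"
    unfolding E_norm_def by (rule cInf_lower[OF mem]) (auto intro!: bdd_belowI[of _ 0])
qed

section \<open>Nontrivial solutions of small energy\<close>

lemma single_site_negative:
  assumes t: "0 < t" "t \<le> 1" "t \<le> d"
    and F: "(a (k - 1) + a k + b k) * t powr q / q < F k t"
  shows "(\<lambda>_. 0)(k := t) \<in> W d" "J ((\<lambda>_. 0)(k := t)) < 0"
proof -
  have d: "0 < d" using t by simp
  note upd = W_update[OF zero_in_W _ t(3) d, of k]
  show "(\<lambda>_. 0)(k := t) \<in> W d" using upd(1) t d by simp
  \<comment> \<open>For \<open>t \<le> 1\<close> and \<open>q \<le> p j\<close>, passing from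
    \<open>p j\<close> to \<open>q\<close> enlarges both the reciprocal and the power; this reduces
    the three energy terms to the single exponent \<open>q\<close>.\<close>
  have le: "x / p j * t powr p j \<le> x / q * t powr q" if "0 < x" for x j
    using that q_gt_1 p_ge[of j] t p_pos[of j]
    by (intro mult_mono divide_left_mono powr_mono') auto
  have "slice (\<lambda>_. 0) k 0 = 0"
    by (simp add: slice_def)
  moreover have "slice (\<lambda>_. 0) k t < 0"
    using le[OF a_pos, of "k - 1" "k - 1"] le[OF a_pos, of k k] le[OF b_pos, of k k] F t
    by (simp add: slice_def distrib_right add_divide_distrib)
  ultimately show "J ((\<lambda>_. 0)(k := t)) < 0"
    using upd(2) t d J_zero by simp
qed

text \<open>The radius \<open>T\<close> is kept apart from \<open>d\<close> so that one constant
  \<open>infsum (M T) UNIV\<close> can serve a whole family of shrinking boxes.\<close>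

lemma positive_solution:
  assumes c: "0 < c" "c < d" and T: "d \<le> T"
    and f_le: "\<And>k t. t \<in> {c..d} \<Longrightarrow> f k t \<le> 0"
    and t: "0 < t" "t \<le> 1" "t \<le> d"
    and F: "(a (k0 - 1) + a k0 + b k0) * t powr q / q < F k0 t"
  obtains u where "u \<in> E_space p a b" "homoclinic_solution p a b f u" "\<And>k. 0 < u k"
    "infsum (energy_term p a b u) UNIV \<le> P * (d * infsum (M T) UNIV)"
proof -
  have d: "0 < d" using c by simp
  obtain u where u: "u \<in> W d" and min: "\<And>v. v \<in> W d \<Longrightarrow> J u \<le> J v"
    using minimizer_exists[OF d] by blast
  have neg: "J u < 0"
    using single_site_negative[OF t F] min by fastforce
  have "\<exists>j. u j \<noteq> 0"
  proof (rule ccontr)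
    assume "\<not> (\<exists>j. u j \<noteq> 0)"
    then have "u = (\<lambda>_. 0)" by auto
    then show False using neg J_zero by simp
  qed
  then have pos: "0 < u k" for k using minimizer_pos[OF d u min] by blast
  have lt: "u k < d" for k using minimizer_le[OF c f_le u min, of k] c by simp
  have Dsum: "D u summable_on UNIV" using u by (simp add: W_def)
  have s: "(\<lambda>k. P * D u k) summable_on UNIV" by (intro summable_on_cmult_right Dsum)
  have en: "energy_term p a b u summable_on UNIV"
    by (rule summable_on_comparison_test[OF s]) (use energy_le_D energy_nonneg in auto)
  \<comment> \<open>Negativity of \<open>J u\<close> says that the energy is less than the
    potential, which is of order \<open>d\<close>.\<close>
  have "infsum (D u) UNIV \<le> (\<Sum>\<^sub>\<infinity>k. F k (u k))" using neg J_eq[OF u d] by simp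
  also have "\<dots> \<le> (\<Sum>\<^sub>\<infinity>k. d * M T k)"
  proof (rule infsum_mono)
    show "(\<lambda>k. F k (u k)) summable_on UNIV" using u d by (intro F_summable) (auto simp: W_def)
    show "(\<lambda>k. d * M T k) summable_on UNIV"
      using d T by (intro summable_on_cmult_right M_summable) simp
    show "F k (u k) \<le> d * M T k" for k
      using F_bound_box[of u d T k] u T by (auto simp: W_def)
  qed
  also have "\<dots> = d * infsum (M T) UNIV"
    using d T by (intro infsum_cmult_right M_summable) simp
  finally have "P * infsum (D u) UNIV \<le> P * (d * infsum (M T) UNIV)"
    using P_pos by simp
  moreover have "infsum (energy_term p a b u) UNIV \<le> (\<Sum>\<^sub>\<infinity>k. P * D u k)"
    by (rule infsum_mono[OF en s energy_le_D])
  moreover have "(\<Sum>\<^sub>\<infinity>k. P * D u k) = P * infsum (D u) UNIV"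
    by (rule infsum_cmult_right) (use Dsum in auto)
  ultimately have "infsum (energy_term p a b u) UNIV \<le> P * (d * infsum (M T) UNIV)" by simp
  moreover have "homoclinic_solution p a b f u"
    unfolding homoclinic_solution_def
    using interior_minimizer_equation[OF u min pos lt] tendsto_0_of_energy[OF en] b_at_top b_at_bot
    by blast
  ultimately show ?thesis using that in_E_space[OF en] pos by blast
qed

lemma E_norm_tendsto_0:
  assumes en: "\<And>n. energy_term p a b (u n) summable_on UNIV"
    and lim: "(\<lambda>n. infsum (energy_term p a b (u n)) UNIV) \<longlonglongrightarrow> 0"
  shows "(\<lambda>n. E_norm p a b (u n)) \<longlonglongrightarrow> 0"
proof (rule tendstoI)
  fix e :: real assume "e > 0"
  define \<eta> where "\<eta> = min (e / 2) 1"
  have \<eta>: "0 < \<eta>" "\<eta> \<le> 1" "\<eta> < e" using \<open>e > 0\<close> by (auto simp: \<eta>_def)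
  have "\<forall>\<^sub>F n in sequentially. infsum (energy_term p a b (u n)) UNIV < \<eta> powr P"
    using lim \<eta> by (intro order_tendstoD(2)) auto
  then show "\<forall>\<^sub>F n in sequentially. dist (E_norm p a b (u n)) 0 < e"
  proof (rule eventually_mono)
    fix n assume "infsum (energy_term p a b (u n)) UNIV < \<eta> powr P"
    then show "dist (E_norm p a b (u n)) 0 < e"
      using E_norm_bounds[OF en \<eta>(1,2), of n] \<eta>(3) by simp
  qed
qed

text \<open>All that the growth conditions (F5), (F6) contribute: for arbitrarily small \<open>t\<close> some site
  \<open>k\<close> has \<open>F k t\<close> above the energy of the single-site sequence of height \<open>t\<close>.\<close>

lemma exists_good_site:
  assumes H: "max (limsup_plus (F_quotient a b f q)) (limsup_minus (F_quotient a b f q))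
          > ereal (1 / q) \<or>
       (SUP k. Limsup (at_right 0) (F_quotient a b f q k)) > ereal (1 / q)"
    and e: "0 < e"
  shows "\<exists>k t. 0 < t \<and> t < e \<and> (a (k - 1) + a k + b k) * t powr q / q < F k t"
proof (rule ccontr)
  assume no: "\<not> ?thesis"
  have small: "F_quotient a b f q k t \<le> ereal (1 / q)" if "0 < t" "t < e" for k t
  proof -
    have "F k t \<le> (a (k - 1) + a k + b k) * t powr q / q"
      using no that by (meson not_le)
    moreover have "0 < (a (k - 1) + a k + b k) * t powr q"
      using a_pos[of k] a_pos[of "k - 1"] b_pos[of k] that by simp
    ultimately show ?thesis
      using q_gt_1 by (simp add: F_quotient_def pos_divide_le_eq)
  qed
  have ev: "\<forall>\<^sub>F t in at_right 0. 0 < t \<and> t < e"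
    using eventually_at_right_real[OF e] by simp
  \<comment> \<open>The bound holds at every site, so the filter in the first coordinate may be
    arbitrary; both ends are instances.\<close>
  have joint: "Limsup (G \<times>\<^sub>F at_right 0) (\<lambda>(k, t). F_quotient a b f q k t) \<le> ereal (1 / q)" for G
  proof (rule Limsup_bounded)
    show "\<forall>\<^sub>F x in G \<times>\<^sub>F at_right 0. (case x of (k, t) \<Rightarrow> F_quotient a b f q k t) \<le> ereal (1 / q)"
      using eventually_prodI[OF eventually_True ev, of G]
      by (rule eventually_mono) (use small in auto)
  qed
  have "Limsup (at_right 0) (F_quotient a b f q k) \<le> ereal (1 / q)" for k
    by (rule Limsup_bounded, rule eventually_mono[OF ev]) (use small in auto)
  then have "(SUP k. Limsup (at_right 0) (F_quotient a b f q k)) \<le> ereal (1 / q)"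
    by (rule SUP_least)
  then show False
    using H joint[of at_top] joint[of at_bot]
    by (auto simp: limsup_plus_def limsup_minus_def max_def not_less[symmetric] split: if_splits)
qed

end

section \<open>Passage to a sequence of shrinking boxes\<close>

theorem theorem2:
  fixes p a b :: "int \<Rightarrow> real" and f :: "int \<Rightarrow> real \<Rightarrow> real" and p_minus :: real
  defines "p_minus \<equiv> (INF k. p k)"
  assumes p_bdd: "bdd_below (range p)" "bdd_above (range p)"
    and p_gt_1: "1 < p_minus"
    and a_pos: "\<And>k. a k > 0"
    and b_pos: "\<And>k. b k > 0"
    and f_cont: "\<And>k. continuous_on UNIV (f k)"
    and A: "filterlim b at_top at_top" "filterlim b at_top at_bot"
    and F1: "\<And>k. f k 0 = 0"
    and F2: "\<And>T. T > 0 \<Longrightarrow> (\<lambda>k. SUP t\<in>{-T..T}. \<bar>f k t\<bar>) summable_on UNIV"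
    and F3: "\<exists>c d :: nat \<Rightarrow> real.
        (\<forall>n. 0 < d (Suc n) \<and> d (Suc n) < c n \<and> c n < d n) \<and> d \<longlonglongrightarrow> 0 \<and>
        (\<forall>k n. \<forall>t\<in>{c n..d n}. f k t \<le> 0)"
    and F5_or_F6:
      "max (limsup_plus (F_quotient a b f p_minus)) (limsup_minus (F_quotient a b f p_minus))
          > ereal (1 / p_minus) \<or>
       (SUP k. Limsup (at_right 0) (F_quotient a b f p_minus k)) > ereal (1 / p_minus)"
  shows "\<exists>u :: nat \<Rightarrow> int \<Rightarrow> real.
      (\<forall>n. u n \<in> E_space p a b \<and> homoclinic_solution p a b f (u n) \<and> (\<forall>k. u n k > 0)) \<and>
      (\<lambda>n. E_norm p a b (u n)) \<longlonglongrightarrow> 0"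

proof -
  obtain P where P: "\<And>k. p k \<le> P" using p_bdd(2) by (auto simp: bdd_above_def)
  interpret discrete_problem p a b f p_minus P
  proof
    show "p_minus \<le> p k" for k
      unfolding p_minus_def using p_bdd(1) by (intro cINF_lower) auto
  qed (fact p_gt_1 P a_pos b_pos f_cont A F1 F2)+
  obtain c d :: "nat \<Rightarrow> real" where cd: "\<And>n. 0 < d (Suc n)" "\<And>n. d (Suc n) < c n" "\<And>n. c n < d n"
    and d_lim: "d \<longlonglongrightarrow> 0" and f_le: "\<And>k n t. t \<in> {c n..d n} \<Longrightarrow> f k t \<le> 0"
    using F3 by blast
  have d_le: "d n \<le> d 0" for n
    by (rule decseqD[OF decseq_SucI])
      (use less_imp_le[OF less_trans[OF cd(2,3)]] in auto)
  have c_pos: "0 < c n" for n using cd(1,2)[of n] by linarith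
  have "\<exists>u. u \<in> E_space p a b \<and> homoclinic_solution p a b f u \<and> (\<forall>k. 0 < u k) \<and>
      infsum (energy_term p a b u) UNIV \<le> P * (d n * infsum (M (d 0)) UNIV)" for n
  proof -
    \<comment> \<open>The height must be at most 1 for the comparison of exponents and at most
      \<open>d n\<close> to fit into the box.\<close>
    have "0 < min 1 (d n)" using c_pos[of n] cd(3)[of n] by simp
    from exists_good_site[OF F5_or_F6 this] obtain k t where
      t: "0 < t" "t < min 1 (d n)" and site: "(a (k - 1) + a k + b k) * t powr p_minus / p_minus < F k t"
      by blast
    then have t_le: "t \<le> 1" "t \<le> d n" by auto
    show ?thesis
      by (rule positive_solution[OF c_pos cd(3) d_le _ t(1) t_le site]) (fact f_le, blast)
  qed
  then obtain u where u: "\<And>n. u n \<in> E_space p a b" "\<And>n. homoclinic_solution p a b f (u n)"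
      "\<And>n k. 0 < u n k"
      "\<And>n. infsum (energy_term p a b (u n)) UNIV \<le> P * (d n * infsum (M (d 0)) UNIV)"
    by metis
  have "(\<lambda>n. infsum (energy_term p a b (u n)) UNIV) \<longlonglongrightarrow> 0"
  proof (rule tendsto_sandwich[OF _ _ tendsto_const])
    show "\<forall>\<^sub>F n in sequentially. 0 \<le> infsum (energy_term p a b (u n)) UNIV"
      by (intro always_eventually allI infsum_nonneg energy_nonneg)
    show "\<forall>\<^sub>F n in sequentially. infsum (energy_term p a b (u n)) UNIV
        \<le> P * (d n * infsum (M (d 0)) UNIV)"
      using u(4) by simp
    \<comment> \<open>The majorant is taken at the largest radius \<open>d 0\<close>, so only the
      factor \<open>d n\<close> varies.\<close>
    show "(\<lambda>n. P * (d n * infsum (M (d 0)) UNIV)) \<longlonglongrightarrow> 0"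
      using d_lim by (auto intro!: tendsto_eq_intros)
  qed
  then have "(\<lambda>n. E_norm p a b (u n)) \<longlonglongrightarrow> 0"
    using u(1) by (intro E_norm_tendsto_0) (auto simp: E_space_def)
  then show ?thesis using u(1-3) by blast
qed

end
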